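(* For any fixed positive integer $d$, there exists an integer $c$ such that there are $n$-vertex graphs $G$ (for arbitrarily large $n$) with neighborhood complexity $\eta_G(m)\le c\,m^d$ for all $m$, for which the size of any biclique cover of $G$ is $\Omega(n^{2-1/d})$ (the implied constant depends only on $d$).
   Context: Graphs are finite, simple and undirected. $N(v)$ denotes the set of neighbors of a vertex $v$. The neighborhood complexity of a graph $G$ is the function $$\eta_G(m)=\max_{C\subseteq V(G),\,|C|=m}\ \bigl|\{N(v)\cap C: v\in V(G)\}\bigr|,\qquad 1\le m\le |V(G)|.$$ A biclique of $G$ is a complete bipartite subgraph of $G$ (not necessarily induced). A biclique cover of $G$ is a collection $\mathcal{B}$ of bicliques of $G$ such that every edge of $G$ is contained in at least one of them; its size is $\sum_{B\in\mathcal{B}}|V(B)|$. *)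

theory Defs
  imports Complex_Main "Graph_Theory.Graph_Theory"
begin

text \<open>
  Finite simple undirected graphs are the locale \<^locale>\<open>pair_graph\<close>: an undirected edge
  is represented by its two opposite arcs.
\<close>

definition neighborhood :: "'a pair_pre_digraph \<Rightarrow> 'a \<Rightarrow> 'a set" where
  "neighborhood G v = {u. (v, u) \<in> parcs G}"

text \<open>Only meaningful for \<open>1 \<le> m \<le> card (pverts G)\<close>; otherwise the maximum may range over the empty set.\<close>

definition neighborhood_complexity :: "'a pair_pre_digraph \<Rightarrow> nat \<Rightarrow> nat" where
  "neighborhood_complexity G m =
     Max {card {neighborhood G v \<inter> C | v. v \<in> pverts G} | C. C \<subseteq> pverts G \<and> card C = m}"

definition biclique :: "'a pair_pre_digraph \<Rightarrow> 'a pair_pre_digraph \<Rightarrow> bool" where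
  "biclique G B \<longleftrightarrow> subgraph (with_proj B) (with_proj G)
     \<and> (\<exists>a b. complete_bipartite_digraph a b (with_proj B))"

text \<open>
  A side of a biclique may be empty. Such bicliques cover no edge and never decrease the size of
  a cover; neither would repeating a biclique, so covers are plain sets.
\<close>

definition biclique_cover :: "'a pair_pre_digraph \<Rightarrow> 'a pair_pre_digraph set \<Rightarrow> bool" where
  "biclique_cover G \<B> \<longleftrightarrow> (\<forall>B\<in>\<B>. biclique G B) \<and> (\<forall>e\<in>parcs G. \<exists>B\<in>\<B>. e \<in> parcs B)"

definition biclique_cover_size :: "'a pair_pre_digraph set \<Rightarrow> nat" where
  "biclique_cover_size \<B> = (\<Sum>B\<in>\<B>. card (pverts B))"

text \<open>So the sum in \<^const>\<open>biclique_cover_size\<close> is never the default value of an infinite sum.\<close>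

lemma finite_biclique_cover:
  assumes "pair_graph G" and "biclique_cover G \<B>"
  shows "finite \<B>"
proof -
  interpret pair_graph G by fact
  let ?mk = "\<lambda>(V, E). \<lparr> pverts = V, parcs = E \<rparr> :: 'a pair_pre_digraph"
  have "\<B> \<subseteq> ?mk ` (Pow (pverts G) \<times> Pow (parcs G))"
  proof
    fix B :: "'a pair_pre_digraph"
    assume "B \<in> \<B>"
    then have "pverts B \<subseteq> pverts G" "parcs B \<subseteq> parcs G"
      using assms(2) by (auto simp: biclique_cover_def biclique_def subgraph_def)
    moreover have "B = ?mk (pverts B, parcs B)" by simp
    ultimately show "B \<in> ?mk ` (Pow (pverts G) \<times> Pow (parcs G))" by blast
  qed
  moreover have "finite (Pow (pverts G) \<times> Pow (parcs G))"
    using pair_finite_verts pair_finite_arcs by simp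
  ultimately show ?thesis by (meson finite_imageI finite_subset)
qed

end

theory Submission
  imports Defs "HOL-Algebra.Algebraic_Closure_Type" "HOL-Library.Z2"
    "HOL-Library.Function_Algebras" "HOL-Library.FuncSet"
begin

text \<open>
  Let \<open>F\<close> be a field with \<open>q\<close> elements and join two copies of \<open>F^d\<close> by the zero set of a function
  \<open>f(x, y)\<close> that is, in \<open>x\<close> and in \<open>y\<close> separately, a polynomial of degree at most \<open>2 d\<close> in each of
  the \<open>d\<close> variables. The graph has \<open>2 q^d\<close> vertices, so a zero set of the typical density \<open>1 / q\<close>
  gives the wanted number of edges \<open>q^(2 d - 1)\<close>. Two independent facts make such a graph work.

  The neighborhood complexity is small for every \<open>f\<close>. The traces on \<open>m\<close> vertices of one side
  are zero patterns of \<open>m\<close> polynomials in \<open>d\<close> variables, and by the argument of Ronyai, Babai and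
  Ganapathy (\<open>card_zero_patterns_le\<close>) each pattern contributes one of a linearly independent family
  of products of these polynomials; such products live in a space of dimension \<open>(2 d m + 1)^d\<close>.

  For a suitable \<open>f\<close> there is no complete bipartite subgraph with \<open>s = 2 d + 1\<close> vertices on each
  side. Interpolation (\<open>bipolynomials_shatter_grids\<close>) shows that the values of a uniformly
  random \<open>f\<close> on an \<open>s\<close> by \<open>s\<close> grid are independent and uniform. Thus a grid vanishes with
  probability \<open>q^(- s^2)\<close>, while there are at most \<open>q^(2 d s)\<close> grids and \<open>s^2 = 2 d s + s\<close>: as in
  a truly random graph of this density, the expected number of vanishing grids is tiny, and
  \<open>first_moment\<close> finds an \<open>f\<close> with many zeros and no vanishing grid.

  Without such subgraphs, every biclique has a side with fewer than \<open>s\<close> vertices, and so covers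
  at most \<open>s\<close> edges per vertex; covering all edges costs at least a fraction \<open>1 / s\<close> of their number.
  To have fields of unbounded size inside a single type, \<open>F\<close> is taken to be the fixed field of a
  power of the Frobenius map in the algebraic closure of the field with two elements.
\<close>

section \<open>Zero patterns of polynomial functions\<close>

interpretation pointwise: vector_space "\<lambda>(c::'k::field) (f::'b \<Rightarrow> 'k) x. c * f x"
  by unfold_locales (auto simp: fun_eq_iff algebra_simps)

lemma sum_fun_apply: "(\<Sum>a\<in>A. f a) x = (\<Sum>a\<in>A. f a x)" for f :: "'a \<Rightarrow> 'b \<Rightarrow> 'c::comm_monoid_add"
  by (induction A rule: infinite_finite_induct) auto

text \<open>
  The functions \<open>g S\<close> are linearly independent because the matrix of the values \<open>g S (y T)\<close> is
  triangular with respect to inclusion: a minimal member of the support of a linear relation is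
  isolated by evaluating the relation at its own point.
\<close>

lemma card_family_le_dimension:
  fixes g :: "'c set \<Rightarrow> 'b \<Rightarrow> 'k::field"
  assumes fin: "finite \<S>" "finite M"
    and span: "\<And>S. S \<in> \<S> \<Longrightarrow> g S \<in> pointwise.span M"
    and incidence: "\<And>S T. S \<in> \<S> \<Longrightarrow> T \<in> \<S> \<Longrightarrow> g S (y T) \<noteq> 0 \<longleftrightarrow> S \<subseteq> T"
  shows "card \<S> \<le> card M"
proof -
  have inj: "inj_on g \<S>"
  proof (rule inj_onI)
    fix S T assume "S \<in> \<S>" "T \<in> \<S>" "g S = g T"
    then show "S = T" using incidence by (metis order_refl subset_antisym)
  qed
  have "pointwise.independent (g ` \<S>)"
  proof (rule pointwise.independent_if_scalars_zero)
    fix u v assume zero: "(\<Sum>v\<in>g ` \<S>. (\<lambda>x. u v * v x)) = 0" and "v \<in> g ` \<S>"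
    have eval: "(\<Sum>S\<in>\<S>. u (g S) * g S z) = 0" for z
    proof -
      have "(\<Sum>v\<in>g ` \<S>. (\<lambda>x. u v * v x)) z = 0" using zero by simp
      then show ?thesis by (simp add: sum_fun_apply sum.reindex[OF inj])
    qed
    show "u v = 0"
    proof (rule ccontr)
      assume "u v \<noteq> 0"
      then have "{S\<in>\<S>. u (g S) \<noteq> 0} \<noteq> {}" using \<open>v \<in> g ` \<S>\<close> by auto
      then obtain S where S: "S \<in> \<S>" "u (g S) \<noteq> 0"
        and minimal: "\<And>T. T \<in> \<S> \<Longrightarrow> u (g T) \<noteq> 0 \<Longrightarrow> T \<subseteq> S \<Longrightarrow> T = S"
        using finite_has_minimal[of "{S\<in>\<S>. u (g S) \<noteq> 0}"] fin by auto
      have "(\<Sum>T\<in>\<S>. u (g T) * g T (y S)) = (\<Sum>T\<in>{S}. u (g T) * g T (y S))"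
        using S minimal incidence fin by (intro sum.mono_neutral_right) auto
      then show False using eval[of "y S"] S incidence[of S S] by simp
    qed
  qed (use fin in simp)
  then have "card (g ` \<S>) \<le> card M"
    using pointwise.independent_span_bound[OF fin(2)] span by blast
  then show ?thesis using card_image[OF inj] by simp
qed

text \<open>
  The bound \<open>D\<close> is on the degree in each variable separately: the monomials are then indexed by a
  box, which makes them trivial to count. The points are functions on all naturals, of which
  only the first \<open>d\<close> coordinates are read.
\<close>

definition polyfuns :: "nat \<Rightarrow> nat \<Rightarrow> ((nat \<Rightarrow> 'k::field) \<Rightarrow> 'k) set" where
  "polyfuns d D = pointwise.span ((\<lambda>\<alpha> x. \<Prod>i<d. x i ^ \<alpha> i) ` (\<Pi>\<^sub>E i\<in>{..<d}. {..D}))"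

lemma polyfuns_scale: "f \<in> polyfuns d D \<Longrightarrow> (\<lambda>x. c * f x) \<in> polyfuns d D"
  unfolding polyfuns_def by (rule pointwise.span_scale)

lemma polyfuns_sum: "(\<And>a. a \<in> A \<Longrightarrow> f a \<in> polyfuns d D) \<Longrightarrow> (\<lambda>x. \<Sum>a\<in>A. f a x) \<in> polyfuns d D"
  using pointwise.span_sum[of A f] unfolding polyfuns_def sum_fun_apply[symmetric] by blast

lemma polyfuns_diff: "f \<in> polyfuns d D \<Longrightarrow> g \<in> polyfuns d D \<Longrightarrow> (\<lambda>x. f x - g x) \<in> polyfuns d D"
  using pointwise.span_diff[of f _ g] unfolding polyfuns_def fun_diff_def by blast

lemma monomial_in_polyfuns:
  assumes "\<And>i. i < d \<Longrightarrow> \<alpha> i \<le> D"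
  shows "(\<lambda>x. \<Prod>i<d. x i ^ \<alpha> i) \<in> polyfuns d D"
proof -
  have "(\<lambda>x :: nat \<Rightarrow> 'k::field. \<Prod>i<d. x i ^ \<alpha> i) = (\<lambda>x. \<Prod>i<d. x i ^ restrict \<alpha> {..<d} i)"
    by (intro ext prod.cong) auto
  then show ?thesis
    unfolding polyfuns_def using assms
    by (intro pointwise.span_base) (auto intro!: image_eqI[of _ _ "restrict \<alpha> {..<d}"] split: if_splits)
qed

lemma polyfuns_const: "(\<lambda>x. c) \<in> polyfuns d D"
  using polyfuns_scale[OF monomial_in_polyfuns[of d "\<lambda>_. 0" D], of c] by simp

lemma polyfuns_coord:
  assumes "i < d"
  shows "(\<lambda>x. x i) \<in> polyfuns d 1"
proof -
  have *: "(\<Prod>j<d. x j ^ (if j = i then 1 else 0)) = x i" for x :: "nat \<Rightarrow> 'k::field"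
    using assms by (subst prod.remove[of _ i]) auto
  have "(\<lambda>x :: nat \<Rightarrow> 'k::field. \<Prod>j<d. x j ^ (if j = i then 1 else 0)) \<in> polyfuns d 1"
    by (rule monomial_in_polyfuns) simp
  then show ?thesis unfolding * .
qed

lemma polyfuns_mult:
  assumes "f \<in> polyfuns d D" "g \<in> polyfuns d E"
  shows "(\<lambda>x. f x * g x) \<in> polyfuns d (D + E)"
proof -
  note sub = pointwise.subspaceI pointwise.span_zero pointwise.span_add pointwise.span_scale
  have mono: "(\<lambda>x. m x * g x) \<in> polyfuns d (D + E)"
    if "\<alpha> \<in> (\<Pi>\<^sub>E i\<in>{..<d}. {..D})" "m = (\<lambda>x. \<Prod>i<d. x i ^ \<alpha> i)" for \<alpha> m
    using assms(2) unfolding polyfuns_def[of d E]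
  proof (induction rule: pointwise.span_induct_alt)
    case base
    show ?case using polyfuns_const[of 0 d "D + E"] by (simp add: zero_fun_def)
  next
    case (step c h k)
    then obtain \<beta> where \<beta>: "\<beta> \<in> (\<Pi>\<^sub>E i\<in>{..<d}. {..E})" "h = (\<lambda>x. \<Prod>i<d. x i ^ \<beta> i)" by blast
    have "(\<lambda>x. m x * h x) = (\<lambda>x. \<Prod>i<d. x i ^ (\<alpha> i + \<beta> i))"
      by (simp add: that \<beta> prod.distrib power_add)
    moreover have "\<alpha> i + \<beta> i \<le> D + E" if "i < d" for i
      using that \<open>\<alpha> \<in> _\<close> \<beta>(1) by (fastforce intro!: add_mono)
    ultimately have "(\<lambda>x. m x * h x) \<in> polyfuns d (D + E)"
      by (simp add: monomial_in_polyfuns)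
    from pointwise.span_add[OF polyfuns_scale[OF this, of c, unfolded polyfuns_def] step(2)[unfolded polyfuns_def]]
    show ?case by (simp add: polyfuns_def plus_fun_def algebra_simps)
  qed
  show ?thesis
    using assms(1) unfolding polyfuns_def[of d D]
  proof (induction rule: pointwise.span_induct_alt)
    case base
    show ?case using polyfuns_const[of 0 d "D + E"] by (simp add: zero_fun_def)
  next
    case (step c m k)
    then have "(\<lambda>x. m x * g x) \<in> polyfuns d (D + E)" using mono by blast
    from pointwise.span_add[OF polyfuns_scale[OF this, of c, unfolded polyfuns_def] step(2)[unfolded polyfuns_def]]
    show ?case by (simp add: polyfuns_def plus_fun_def algebra_simps)
  qed
qed

lemma polyfuns_mono:
  assumes "f \<in> polyfuns d D" "D \<le> E"
  shows "f \<in> polyfuns d E"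
  using polyfuns_mult[OF assms(1) polyfuns_const[of 1 d "E - D"]] assms(2) by simp

lemma polyfuns_prod:
  assumes "finite A" "\<And>a. a \<in> A \<Longrightarrow> f a \<in> polyfuns d D"
  shows "(\<lambda>x. \<Prod>a\<in>A. f a x) \<in> polyfuns d (card A * D)"
  using assms
proof (induction A)
  case empty
  show ?case using polyfuns_const[of 1 d 0] by simp
next
  case (insert a A)
  then show ?case using polyfuns_mult[of "f a" d D "\<lambda>x. \<Prod>a\<in>A. f a x" "card A * D"] by simp
qed

text \<open>
  For each pattern, choose a point that realizes it and multiply those \<open>p c\<close> that do not vanish
  there. Such a product is nonzero at the point of another pattern exactly when
  the supports are nested, so the patterns are bounded by the dimension of the space that contains
  the products.
\<close>

lemma card_zero_patterns_le:
  fixes p :: "'c \<Rightarrow> (nat \<Rightarrow> 'k::field) \<Rightarrow> 'k"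
  assumes "finite C" and p: "\<And>c. c \<in> C \<Longrightarrow> p c \<in> polyfuns d D"
  shows "card ((\<lambda>y. {c\<in>C. p c y = 0}) ` Y) \<le> (card C * D + 1) ^ d"
proof -
  define supp where "supp y = {c\<in>C. p c y \<noteq> 0}" for y
  define w where "w S = (SOME y. supp y = S)" for S
  have w: "supp (w S) = S" if "S \<in> supp ` Y" for S
    using that someI_ex[of "\<lambda>y. supp y = S"] unfolding w_def by blast
  have sub: "S \<subseteq> C" if "S \<in> supp ` Y" for S using that by (auto simp: supp_def)
  let ?M = "(\<lambda>\<alpha> x. \<Prod>i<d. x i ^ \<alpha> i) ` (\<Pi>\<^sub>E i\<in>{..<d}. {..card C * D}) :: ((nat \<Rightarrow> 'k) \<Rightarrow> 'k) set"
  have "card (supp ` Y) \<le> card ?M"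
  proof (rule card_family_le_dimension[where g = "\<lambda>S x. \<Prod>c\<in>S. p c x" and y = w])
    show "finite (supp ` Y)"
      by (rule finite_subset[of _ "Pow C"]) (use assms in \<open>auto simp: supp_def\<close>)
    show "finite ?M" by (intro finite_imageI finite_PiE) auto
    show "(\<lambda>x. \<Prod>c\<in>S. p c x) \<in> pointwise.span ?M" if "S \<in> supp ` Y" for S
    proof -
      have "(\<lambda>x. \<Prod>c\<in>S. p c x) \<in> polyfuns d (card S * D)"
        using sub[OF that] p \<open>finite C\<close> by (intro polyfuns_prod) (auto intro: finite_subset)
      moreover have "card S * D \<le> card C * D"
        using sub[OF that] \<open>finite C\<close> by (simp add: card_mono)
      ultimately have "(\<lambda>x. \<Prod>c\<in>S. p c x) \<in> polyfuns d (card C * D)" by (rule polyfuns_mono)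
      then show ?thesis by (simp add: polyfuns_def)
    qed
    show "(\<Prod>c\<in>S. p c (w T)) \<noteq> 0 \<longleftrightarrow> S \<subseteq> T" if "S \<in> supp ` Y" "T \<in> supp ` Y" for S T
    proof -
      have "finite S" using sub[OF that(1)] \<open>finite C\<close> by (rule finite_subset)
      then have "(\<Prod>c\<in>S. p c (w T)) \<noteq> 0 \<longleftrightarrow> (\<forall>c\<in>S. p c (w T) \<noteq> 0)" by simp
      also have "\<dots> \<longleftrightarrow> S \<subseteq> supp (w T)" using sub[OF that(1)] by (auto simp: supp_def)
      finally show ?thesis using w[OF that(2)] by simp
    qed
  qed
  also have "\<dots> \<le> card (\<Pi>\<^sub>E i\<in>{..<d}. {..card C * D})" by (intro card_image_le finite_PiE) auto
  also have "\<dots> = (card C * D + 1) ^ d" by (simp add: card_PiE)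
  finally have "card (supp ` Y) \<le> (card C * D + 1) ^ d" .
  moreover have "(\<lambda>y. {c\<in>C. p c y = 0}) ` Y = (\<lambda>S. C - S) ` supp ` Y"
    unfolding image_image by (intro image_cong) (auto simp: supp_def)
  moreover have "card ((\<lambda>S. C - S) ` supp ` Y) \<le> card (supp ` Y)"
    by (intro card_image_le finite_subset[of "supp ` Y" "Pow C"]) (use assms in \<open>auto simp: supp_def\<close>)
  ultimately show ?thesis by simp
qed

text \<open>
  Closure under differences already gives sums and negatives. With \<open>inverse 0 = 0\<close> the inverse of
  \<open>0\<close> needs no exception.
\<close>

definition finite_subfield :: "'k::field set \<Rightarrow> bool" where
  "finite_subfield F \<longleftrightarrow> finite F \<and> 0 \<in> F \<and> 1 \<in> F \<and> (\<forall>x\<in>F. \<forall>y\<in>F. x - y \<in> F \<and> x * y \<in> F)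
     \<and> (\<forall>x\<in>F. inverse x \<in> F)"

text \<open>
  A Lagrange basis function in several variables: each other point \<open>b\<close> differs from \<open>a\<close> in some
  coordinate, and a linear factor in this coordinate alone separates the two. Hence \<open>D\<close> factors
  suffice for \<open>D + 1\<close> points.
\<close>

lemma ex_interpolating_polyfun:
  assumes F: "finite_subfield F" and T: "finite T" "T \<subseteq> (\<Pi>\<^sub>E i\<in>{..<d}. F)" "card T \<le> Suc D" and "a \<in> T"
  shows "\<exists>L\<in>polyfuns d D. (\<forall>y\<in>(\<Pi>\<^sub>E i\<in>{..<d}. F). L y \<in> F) \<and> (\<forall>b\<in>T. L b = (if b = a then 1 else 0))"
proof -
  have "\<exists>i<d. a i \<noteq> b i" if "b \<in> T - {a}" for b
    using that T(2) \<open>a \<in> T\<close> PiE_ext[of a "{..<d}" "\<lambda>_. F" b] by blast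
  then obtain i where i: "\<And>b. b \<in> T - {a} \<Longrightarrow> i b < d \<and> a (i b) \<noteq> b (i b)" by metis
  define L where "L y = (\<Prod>b\<in>T - {a}. inverse (a (i b) - b (i b)) * (y (i b) - b (i b)))" for y
  have "L \<in> polyfuns d (card (T - {a}) * 1)"
    unfolding L_def using T i
    by (intro polyfuns_prod polyfuns_scale polyfuns_diff polyfuns_coord polyfuns_const) auto
  then have "L \<in> polyfuns d D"
    by (rule polyfuns_mono) (use T \<open>a \<in> T\<close> in \<open>simp add: card_Diff_singleton\<close>)
  moreover have "L y \<in> F" if "y \<in> (\<Pi>\<^sub>E i\<in>{..<d}. F)" for y
  proof -
    have "inverse (a (i b) - b (i b)) * (y (i b) - b (i b)) \<in> F" if "b \<in> T - {a}" for b
    proof -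
      have "a (i b) \<in> F" "b (i b) \<in> F" "y (i b) \<in> F"
        using i[OF that] that T(2) \<open>a \<in> T\<close> \<open>y \<in> _\<close> by (auto simp: PiE_iff)
      then show ?thesis using F by (simp add: finite_subfield_def)
    qed
    then have "(\<Prod>b\<in>B. inverse (a (i b) - b (i b)) * (y (i b) - b (i b))) \<in> F" if "B \<subseteq> T - {a}" for B
      using that F by (induction B rule: infinite_finite_induct) (auto simp: finite_subfield_def)
    then show ?thesis by (simp add: L_def)
  qed
  moreover have "L a = 1" using i by (auto simp: L_def intro!: prod.neutral)
  moreover have "L b = 0" if "b \<in> T" "b \<noteq> a" for b
    unfolding L_def by (rule prod_zero) (use that T(1) in \<open>auto intro: bexI[of _ b]\<close>)
  ultimately show ?thesis by (intro bexI[of _ L]) auto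
qed

section \<open>Random polynomials over a finite field\<close>

text \<open>
  Let \<open>f\<close> be uniform in the additive group \<open>\<Phi>\<close> and \<open>q = card F\<close>. The fibers of the evaluation at a
  point are empty or translates of each other, so \<open>f\<close> has on average at least a fraction \<open>1 / q\<close> of
  \<open>\<Omega>\<close> as zeros. The evaluation on a member of \<open>\<G>\<close> is onto \<open>F^r\<close>, so \<open>f\<close> vanishes on it with probability
  at most \<open>q^(-r)\<close>. Charging \<open>card \<Omega>\<close> zeros to each member of \<open>\<G>\<close> on which \<open>f\<close> vanishes costs at most half
  of this on average, so some \<open>f\<close> keeps a fraction \<open>1 / (2 * q)\<close> after the charge; as it has at most
  \<open>card \<Omega>\<close> zeros, it vanishes on no member. All probabilities are multiplied out to counts.
\<close>

lemma first_moment: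
  fixes \<Phi> :: "('z \<Rightarrow> 'k::ab_group_add) set"
  assumes \<Phi>: "finite \<Phi>" "\<Phi> \<noteq> {}" "\<And>f g. f \<in> \<Phi> \<Longrightarrow> g \<in> \<Phi> \<Longrightarrow> (\<lambda>z. f z - g z) \<in> \<Phi>"
    and range: "\<And>f z. f \<in> \<Phi> \<Longrightarrow> z \<in> \<Omega> \<Longrightarrow> f z \<in> F" and "finite F" "finite \<Omega>" "\<Omega> \<noteq> {}"
    and \<G>: "finite \<G>" "\<And>T. T \<in> \<G> \<Longrightarrow> T \<subseteq> \<Omega> \<and> card T = r"
    and shatter: "\<And>T w. T \<in> \<G> \<Longrightarrow> w \<in> (\<Pi>\<^sub>E t\<in>T. F) \<Longrightarrow> \<exists>f\<in>\<Phi>. \<forall>t\<in>T. f t = w t"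
    and few: "2 * card F * card \<G> \<le> card F ^ r"
  shows "\<exists>f\<in>\<Phi>. card \<Omega> \<le> 2 * card F * card {z\<in>\<Omega>. f z = 0} \<and> (\<forall>T\<in>\<G>. \<exists>t\<in>T. f t \<noteq> 0)"
proof (rule ccontr)
  define q where "q = card F"
  define Z where "Z f = {z\<in>\<Omega>. f z = 0}" for f :: "'z \<Rightarrow> 'k"
  define B where "B f = {T\<in>\<G>. \<forall>t\<in>T. f t = 0}" for f :: "'z \<Rightarrow> 'k"
  assume "\<not> ?thesis"
  then have none: "2 * q * card (Z f) < card \<Omega> \<or> B f \<noteq> {}" if "f \<in> \<Phi>" for f
    using that unfolding q_def Z_def B_def by (force simp: not_le)

  have zeros: "card \<Phi> \<le> q * card {f\<in>\<Phi>. f z = 0}" if "z \<in> \<Omega>" for z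
  proof -
    have fibre: "card {f\<in>\<Phi>. f z = c} \<le> card {f\<in>\<Phi>. f z = 0}" for c
    proof (cases "\<exists>g\<in>\<Phi>. g z = c")
      case True
      then obtain g where g: "g \<in> \<Phi>" "g z = c" by blast
      show ?thesis
      proof (rule card_inj_on_le[where f = "\<lambda>f x. f x - g x"])
        show "inj_on (\<lambda>f x. f x - g x) {f\<in>\<Phi>. f z = c}" by (auto simp: inj_on_def fun_eq_iff)
      qed (use g \<Phi> in auto)
    next
      case False
      then have "{f\<in>\<Phi>. f z = c} = {}" by blast
      then show ?thesis by (simp only: card.empty le0)
    qed
    have "\<Phi> = (\<Union>c\<in>F. {f\<in>\<Phi>. f z = c})" using range that by blast
    then have "card \<Phi> = card (\<Union>c\<in>F. {f\<in>\<Phi>. f z = c})" by simp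
    also have "\<dots> \<le> (\<Sum>c\<in>F. card {f\<in>\<Phi>. f z = c})" using \<open>finite F\<close> by (rule card_UN_le)
    also have "\<dots> \<le> (\<Sum>c\<in>F. card {f\<in>\<Phi>. f z = 0})" using fibre by (rule sum_mono)
    finally show ?thesis by (simp add: q_def)
  qed
  have vanish: "card {f\<in>\<Phi>. \<forall>t\<in>T. f t = 0} * q ^ r \<le> card \<Phi>" if "T \<in> \<G>" for T
  proof -
    have T: "finite T" "card T = r" using \<G>(2)[OF that] \<open>finite \<Omega>\<close> by (auto intro: finite_subset)
    obtain g where g: "\<And>w. w \<in> (\<Pi>\<^sub>E t\<in>T. F) \<Longrightarrow> g w \<in> \<Phi> \<and> (\<forall>t\<in>T. g w t = w t)"
      using shatter[OF \<open>T \<in> \<G>\<close>] by metis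
    \<comment> \<open>Subtracting \<open>g w\<close> moves the functions vanishing on \<open>T\<close> to those with the values \<open>- w\<close> there.\<close>
    have "card ({f\<in>\<Phi>. \<forall>t\<in>T. f t = 0} \<times> (\<Pi>\<^sub>E t\<in>T. F)) \<le> card \<Phi>"
    proof (rule card_inj_on_le[where f = "\<lambda>(f, w) x. f x - g w x"])
      show "inj_on (\<lambda>(f, w) x. f x - g w x) ({f\<in>\<Phi>. \<forall>t\<in>T. f t = 0} \<times> (\<Pi>\<^sub>E t\<in>T. F))"
      proof (rule inj_onI, clarify)
        fix f w f' w'
        assume f: "\<forall>t\<in>T. f t = 0" "\<forall>t\<in>T. f' t = 0" and w: "w \<in> (\<Pi>\<^sub>E t\<in>T. F)" "w' \<in> (\<Pi>\<^sub>E t\<in>T. F)"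
          and "(\<lambda>x. f x - g w x) = (\<lambda>x. f' x - g w' x)"
        then have eq: "f x - g w x = f' x - g w' x" for x by meson
        have "w t = w' t" if "t \<in> T" for t
          using eq[of t] f g[OF w(1)] g[OF w(2)] that by simp
        then have "w = w'" using PiE_ext[OF w] by blast
        moreover have "f x = f' x" for x using eq[of x] by (simp add: \<open>w = w'\<close>)
        ultimately show "f = f' \<and> w = w'" by blast
      qed
    qed (use \<Phi> g in auto)
    then show ?thesis using T by (simp add: card_cartesian_product card_PiE q_def)
  qed

  have many: "card \<Omega> * card \<Phi> \<le> q * (\<Sum>f\<in>\<Phi>. card (Z f))"
  proof -
    have "card \<Omega> * card \<Phi> = (\<Sum>z\<in>\<Omega>. card \<Phi>)" by simp
    also have "\<dots> \<le> (\<Sum>z\<in>\<Omega>. q * card {f\<in>\<Phi>. f z = 0})" using zeros by (rule sum_mono)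
    also have "\<dots> = q * (\<Sum>z\<in>\<Omega>. card {f\<in>\<Phi>. f z = 0})" by (rule sum_distrib_left[symmetric])
    also have "(\<Sum>z\<in>\<Omega>. card {f\<in>\<Phi>. f z = 0}) = (\<Sum>f\<in>\<Phi>. card (Z f))"
      unfolding Z_def using \<open>finite \<Omega>\<close> \<Phi>(1) by (intro sum_multicount_gen) auto
    finally show ?thesis .
  qed
  have bad: "(\<Sum>f\<in>\<Phi>. card (B f)) * q ^ r \<le> card \<G> * card \<Phi>"
  proof -
    have "(\<Sum>f\<in>\<Phi>. card (B f)) = (\<Sum>T\<in>\<G>. card {f\<in>\<Phi>. \<forall>t\<in>T. f t = 0})"
      unfolding B_def using \<Phi>(1) \<open>finite \<G>\<close> by (intro sum_multicount_gen) auto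
    then have "(\<Sum>f\<in>\<Phi>. card (B f)) * q ^ r = (\<Sum>T\<in>\<G>. card {f\<in>\<Phi>. \<forall>t\<in>T. f t = 0} * q ^ r)"
      by (simp add: sum_distrib_right)
    also have "\<dots> \<le> (\<Sum>T\<in>\<G>. card \<Phi>)" using vanish by (rule sum_mono)
    finally show ?thesis by simp
  qed
  have "2 * q * card (Z f) < card \<Omega> + 2 * q * card \<Omega> * card (B f)" if "f \<in> \<Phi>" for f
  proof (cases "B f = {}")
    case False
    have "finite (B f)" using \<open>finite \<G>\<close> by (simp add: B_def)
    with False have "1 \<le> card (B f)" by (simp add: Suc_le_eq card_gt_0_iff)
    have "card (Z f) \<le> card \<Omega>" using \<open>finite \<Omega>\<close> by (auto simp: Z_def intro: card_mono)
    then have "2 * q * card (Z f) \<le> 2 * q * card \<Omega> * card (B f)"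
      using mult_le_mono[OF mult_le_mono2 \<open>1 \<le> card (B f)\<close>, of "card (Z f)" "card \<Omega>" "2 * q"] by simp
    moreover have "0 < card \<Omega>" using \<open>finite \<Omega>\<close> \<open>\<Omega> \<noteq> {}\<close> by (simp add: card_gt_0_iff)
    ultimately show ?thesis by linarith
  qed (use none[OF that] in simp)
  then have "(\<Sum>f\<in>\<Phi>. 2 * q * card (Z f)) < (\<Sum>f\<in>\<Phi>. card \<Omega> + 2 * q * card \<Omega> * card (B f))"
    using \<Phi> by (intro sum_strict_mono) auto
  also have "\<dots> = card \<Omega> * card \<Phi> + 2 * q * card \<Omega> * (\<Sum>f\<in>\<Phi>. card (B f))"
    by (simp add: sum.distrib sum_distrib_left)
  also have "(\<Sum>f\<in>\<Phi>. 2 * q * card (Z f)) = 2 * (q * (\<Sum>f\<in>\<Phi>. card (Z f)))"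
    by (simp add: sum_distrib_left mult.assoc)
  finally have "card \<Omega> * card \<Phi> < 2 * q * card \<Omega> * (\<Sum>f\<in>\<Phi>. card (B f))"
    using many by linarith
  then have "card \<Omega> * card \<Phi> < card \<Omega> * (2 * q * (\<Sum>f\<in>\<Phi>. card (B f)))"
    by (simp only: mult.assoc mult.left_commute[of "card \<Omega>"])
  then have lt: "card \<Phi> < 2 * q * (\<Sum>f\<in>\<Phi>. card (B f))" by simp
  then have "0 < q" by (cases q) auto
  have "card \<Phi> * q ^ r < 2 * q * (\<Sum>f\<in>\<Phi>. card (B f)) * q ^ r"
    using lt \<open>0 < q\<close> by simp
  also have "\<dots> = 2 * q * ((\<Sum>f\<in>\<Phi>. card (B f)) * q ^ r)" by (simp only: mult.assoc)
  also have "\<dots> \<le> 2 * q * (card \<G> * card \<Phi>)" using bad by (rule mult_le_mono2)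
  also have "\<dots> = (2 * q * card \<G>) * card \<Phi>" by simp
  also have "\<dots> \<le> q ^ r * card \<Phi>" using few unfolding q_def by (rule mult_le_mono1)
  finally show False by simp
qed

text \<open>
  The points of \<open>F^d\<close> are accessed through an enumeration \<open>e\<close>, since the vertices of the graph will
  be numbers. Only the values are required to lie in \<open>F\<close>, not the coefficients of the
  polynomials, so that the sample space is finite for the plain reason that it consists
  of \<open>F\<close>-valued functions on a finite set, extended by \<open>0\<close>.
\<close>

definition bipolynomials :: "nat \<Rightarrow> nat \<Rightarrow> 'k::field set \<Rightarrow> nat set \<Rightarrow> (nat \<Rightarrow> nat \<Rightarrow> 'k) \<Rightarrow> (nat \<times> nat \<Rightarrow> 'k) set" where
  "bipolynomials d D F I e = {f.
     (\<forall>z. (z \<in> I \<times> I \<longrightarrow> f z \<in> F) \<and> (z \<notin> I \<times> I \<longrightarrow> f z = 0)) \<and>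
     (\<forall>i\<in>I. \<exists>g\<in>polyfuns d D. \<forall>j\<in>I. f (i, j) = g (e j)) \<and>
     (\<forall>j\<in>I. \<exists>g\<in>polyfuns d D. \<forall>i\<in>I. f (i, j) = g (e i))}"

lemma bipolynomials_diff:
  assumes fg: "f \<in> bipolynomials d D F I e" "g \<in> bipolynomials d D F I e" and F: "finite_subfield F"
  shows "(\<lambda>z. f z - g z) \<in> bipolynomials d D F I e"
  unfolding bipolynomials_def
proof (intro CollectI conjI allI ballI)
  fix z
  show "z \<in> I \<times> I \<longrightarrow> f z - g z \<in> F"
    using fg F by (cases z) (auto simp: bipolynomials_def finite_subfield_def)
  show "z \<notin> I \<times> I \<longrightarrow> f z - g z = 0"
    using fg by (cases z) (auto simp: bipolynomials_def)
next
  fix i assume "i \<in> I"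
  then obtain p p' where "p \<in> polyfuns d D" "\<forall>j\<in>I. f (i, j) = p (e j)"
    "p' \<in> polyfuns d D" "\<forall>j\<in>I. g (i, j) = p' (e j)"
    using fg unfolding bipolynomials_def by blast
  then show "\<exists>h\<in>polyfuns d D. \<forall>j\<in>I. f (i, j) - g (i, j) = h (e j)"
    by (intro bexI[OF _ polyfuns_diff[of p d D p']]) auto
next
  fix j assume "j \<in> I"
  then obtain p p' where "p \<in> polyfuns d D" "\<forall>i\<in>I. f (i, j) = p (e i)"
    "p' \<in> polyfuns d D" "\<forall>i\<in>I. g (i, j) = p' (e i)"
    using fg unfolding bipolynomials_def by blast
  then show "\<exists>h\<in>polyfuns d D. \<forall>i\<in>I. f (i, j) - g (i, j) = h (e i)"
    by (intro bexI[OF _ polyfuns_diff[of p d D p']]) auto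
qed

text \<open>
  Products of Lagrange basis functions in \<open>x\<close> and in \<open>y\<close> are the indicators of the points of
  the grid.
\<close>

lemma bipolynomials_shatter_grids:
  assumes F: "finite_subfield F" and e: "bij_betw e I (\<Pi>\<^sub>E i\<in>{..<d}. F)"
    and S: "S \<subseteq> I" "card S \<le> Suc D" and T: "T \<subseteq> I" "card T \<le> Suc D"
    and w: "w \<in> (\<Pi>\<^sub>E z\<in>S \<times> T. F)"
  shows "\<exists>f\<in>bipolynomials d D F I e. \<forall>z\<in>S \<times> T. f z = w z"
proof -
  have "finite (\<Pi>\<^sub>E i\<in>{..<d}. F)" using F by (intro finite_PiE) (auto simp: finite_subfield_def)
  then have "finite I" using e bij_betw_finite by blast
  have inj: "inj_on e I" and img: "e ` I = (\<Pi>\<^sub>E i\<in>{..<d}. F)" using e by (auto simp: bij_betw_def)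
  have interp: "\<exists>L. \<forall>a\<in>A. L a \<in> polyfuns d D \<and> (\<forall>j\<in>I. L a (e j) \<in> F) \<and> (\<forall>b\<in>A. L a (e b) = (if b = a then 1 else 0))"
    if A: "A \<subseteq> I" "card A \<le> Suc D" for A
  proof (rule bchoice, rule ballI)
    fix a assume "a \<in> A"
    have "finite A" using A(1) \<open>finite I\<close> by (rule finite_subset)
    moreover have "card (e ` A) \<le> Suc D" using card_image_le[OF \<open>finite A\<close>, of e] A(2) by linarith
    moreover have "e ` A \<subseteq> (\<Pi>\<^sub>E i\<in>{..<d}. F)" using A(1) img by blast
    ultimately obtain L where L: "L \<in> polyfuns d D" "\<And>y. y \<in> (\<Pi>\<^sub>E i\<in>{..<d}. F) \<Longrightarrow> L y \<in> F"
      "\<And>b. b \<in> e ` A \<Longrightarrow> L b = (if b = e a then 1 else 0)"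
      using ex_interpolating_polyfun[OF F, of "e ` A" d D "e a"] \<open>a \<in> A\<close> by blast
    have "e b = e a \<longleftrightarrow> b = a" if "b \<in> A" for b
      using inj_on_eq_iff[OF inj, of b a] that \<open>a \<in> A\<close> A(1) by blast
    then show "\<exists>L. L \<in> polyfuns d D \<and> (\<forall>j\<in>I. L (e j) \<in> F) \<and> (\<forall>b\<in>A. L (e b) = (if b = a then 1 else 0))"
      using L img[symmetric] by (intro exI[of _ L]) auto
  qed
  obtain L where L: "\<And>a. a \<in> S \<Longrightarrow> L a \<in> polyfuns d D" "\<And>a j. a \<in> S \<Longrightarrow> j \<in> I \<Longrightarrow> L a (e j) \<in> F"
    "\<And>a b. a \<in> S \<Longrightarrow> b \<in> S \<Longrightarrow> L a (e b) = (if b = a then 1 else 0)"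
    using interp[OF S] by metis
  obtain M where M: "\<And>a. a \<in> T \<Longrightarrow> M a \<in> polyfuns d D" "\<And>a j. a \<in> T \<Longrightarrow> j \<in> I \<Longrightarrow> M a (e j) \<in> F"
    "\<And>a b. a \<in> T \<Longrightarrow> b \<in> T \<Longrightarrow> M a (e b) = (if b = a then 1 else 0)"
    using interp[OF T] by metis
  define h where "h x y = (\<Sum>a\<in>S. \<Sum>b\<in>T. w (a, b) * L a x * M b y)" for x y
  define f where "f z = (if z \<in> I \<times> I then h (e (fst z)) (e (snd z)) else 0)" for z
  have zero: "0 \<in> F" and mult: "\<And>x y. x \<in> F \<Longrightarrow> y \<in> F \<Longrightarrow> x * y \<in> F"
    and diff: "\<And>x y. x \<in> F \<Longrightarrow> y \<in> F \<Longrightarrow> x - y \<in> F"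
    using F by (auto simp: finite_subfield_def)
  have add: "x + y \<in> F" if "x \<in> F" "y \<in> F" for x y
    using diff[OF that(1) diff[OF zero that(2)]] by simp
  have sum_in: "(\<Sum>a\<in>A. u a) \<in> F" if "\<And>a. a \<in> A \<Longrightarrow> u a \<in> F" for u :: "nat \<Rightarrow> 'a" and A
    using that by (induction A rule: infinite_finite_induct) (auto intro: zero add)
  have "f \<in> bipolynomials d D F I e"
    unfolding bipolynomials_def
  proof (intro CollectI conjI allI ballI)
    fix z show "z \<in> I \<times> I \<longrightarrow> f z \<in> F"
      using w L(2) M(2) by (auto simp: f_def h_def PiE_iff intro!: sum_in mult)
    show "z \<notin> I \<times> I \<longrightarrow> f z = 0" by (simp add: f_def)
  next
    fix i assume "i \<in> I"
    have "(\<lambda>y. h (e i) y) \<in> polyfuns d D"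
      unfolding h_def by (intro polyfuns_sum polyfuns_scale M)
    then show "\<exists>g\<in>polyfuns d D. \<forall>j\<in>I. f (i, j) = g (e j)"
      using \<open>i \<in> I\<close> by (intro bexI) (auto simp: f_def)
  next
    fix j assume "j \<in> I"
    have "(\<lambda>x. h x (e j)) = (\<lambda>x. \<Sum>a\<in>S. \<Sum>b\<in>T. (w (a, b) * M b (e j)) * L a x)"
      by (simp add: h_def mult_ac)
    also have "\<dots> \<in> polyfuns d D"
      by (intro polyfuns_sum polyfuns_scale L)
    finally show "\<exists>g\<in>polyfuns d D. \<forall>i\<in>I. f (i, j) = g (e i)"
      using \<open>j \<in> I\<close> by (intro bexI[of _ "\<lambda>x. h x (e j)"]) (auto simp: f_def)
  qed
  moreover have "f (a, b) = w (a, b)" if "a \<in> S" "b \<in> T" for a b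
  proof -
    have fin: "finite S" "finite T" using S T \<open>finite I\<close> by (auto intro: finite_subset)
    have "h (e a) (e b) = (\<Sum>a'\<in>S. \<Sum>b'\<in>T. if b' = b then (if a' = a then w (a, b) else 0) else 0)"
      unfolding h_def using that by (intro sum.cong) (auto simp: L M)
    also have "\<dots> = w (a, b)" using fin that by simp
    finally show ?thesis using that S T by (auto simp: f_def)
  qed
  ultimately show ?thesis by blast
qed

text \<open>
  Grids of side \<open>s = 2 d + 1\<close> need the degree bound \<open>s - 1 = 2 d\<close>. The side is chosen such that
  \<open>s * s\<close> exceeds \<open>2 * d * s\<close>, the exponent of \<open>q\<close> in the bound on the number of grids, by at least
  the \<open>2\<close> that pays for the factor \<open>2 * q\<close> in the first moment argument.
\<close>

lemma ex_dense_grid_free_relation: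
  fixes F :: "'k::field set"
  assumes F: "finite_subfield F" "card F = q" and d: "d \<ge> 1" and n: "n = q ^ d"
  shows "\<exists>E \<subseteq> {..<n} \<times> {..<n}. q ^ (2 * d - 1) \<le> 2 * card E \<and>
     (\<forall>S T. card S = 2 * d + 1 \<longrightarrow> card T = 2 * d + 1 \<longrightarrow> \<not> S \<times> T \<subseteq> E) \<and>
     (\<forall>C \<subseteq> {..<n}. card ((\<lambda>i. {j\<in>C. (i, j) \<in> E}) ` {..<n}) \<le> (card C * (2 * d) + 1) ^ d) \<and>
     (\<forall>C \<subseteq> {..<n}. card ((\<lambda>j. {i\<in>C. (i, j) \<in> E}) ` {..<n}) \<le> (card C * (2 * d) + 1) ^ d)"
proof -
  define s where "s = 2 * d + 1"
  define \<Omega> where "\<Omega> = {..<n} \<times> {..<n}"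
  define P where "P = {S. S \<subseteq> {..<n} \<and> card S = s}"
  define \<G> where "\<G> = (\<lambda>(S, T). S \<times> T) ` (P \<times> P)"
  have finF: "finite F" and "{0, 1} \<subseteq> F" using F by (auto simp: finite_subfield_def)
  then have "card {0, 1 :: 'k} \<le> q" using F(2) card_mono by metis
  then have q: "q \<ge> 2" by simp
  have "card (\<Pi>\<^sub>E i\<in>{..<d}. F) = n" using F n by (simp add: card_PiE)
  moreover have "finite (\<Pi>\<^sub>E i\<in>{..<d}. F)" using finF by (intro finite_PiE) auto
  ultimately obtain e where e: "bij_betw e {..<n} (\<Pi>\<^sub>E i\<in>{..<d}. F)"
    using ex_bij_betw_nat_finite[of "\<Pi>\<^sub>E i\<in>{..<d}. F"] by (auto simp: atLeast0LessThan)
  define \<Phi> where "\<Phi> = bipolynomials d (2 * d) F {..<n} e"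

  have "\<exists>f\<in>\<Phi>. card \<Omega> \<le> 2 * card F * card {z\<in>\<Omega>. f z = 0} \<and> (\<forall>T\<in>\<G>. \<exists>t\<in>T. f t \<noteq> 0)"
  proof (rule first_moment[where r = "s * s"])
    show "finite \<Phi>"
      by (rule finite_subset[OF _ finite_set_of_finite_funs[of \<Omega> F 0]])
        (use finF in \<open>auto simp: \<Phi>_def bipolynomials_def \<Omega>_def\<close>)
    show "\<Phi> \<noteq> {}"
      using bipolynomials_shatter_grids[OF F(1) e, of "{}" "2 * d" "{}" "\<lambda>_. undefined"]
      by (auto simp: \<Phi>_def)
    show "(\<lambda>z. f z - g z) \<in> \<Phi>" if "f \<in> \<Phi>" "g \<in> \<Phi>" for f g
      using that F(1) unfolding \<Phi>_def by (rule bipolynomials_diff)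
    show "f z \<in> F" if "f \<in> \<Phi>" "z \<in> \<Omega>" for f z
      using that by (auto simp: \<Phi>_def bipolynomials_def \<Omega>_def)
    show "finite F" "finite \<Omega>" using finF by (simp_all add: \<Omega>_def)
    show "\<Omega> \<noteq> {}" using q n by (simp add: \<Omega>_def lessThan_empty_iff)
    have finP: "finite P" by (rule finite_subset[of _ "Pow {..<n}"]) (auto simp: P_def)
    then show "finite \<G>" by (simp add: \<G>_def)
    show "T \<subseteq> \<Omega> \<and> card T = s * s" if "T \<in> \<G>" for T
      using that by (auto simp: \<G>_def \<Omega>_def P_def card_cartesian_product)
    show "\<exists>f\<in>\<Phi>. \<forall>t\<in>T. f t = w t" if "T \<in> \<G>" "w \<in> (\<Pi>\<^sub>E t\<in>T. F)" for T w
    proof -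
      from that(1) obtain A B where "T = A \<times> B" "A \<in> P" "B \<in> P" by (auto simp: \<G>_def)
      then show ?thesis
        using that(2) unfolding \<Phi>_def
        by (intro bipolynomials_shatter_grids[OF F(1) e, of A "2 * d" B w, folded \<open>T = A \<times> B\<close>])
          (auto simp: P_def s_def)
    qed
    have "card P = n choose s" using n_subsets[OF finite_lessThan, of n s] by (simp only: P_def card_lessThan)
    also have "\<dots> \<le> n ^ s" by (cases "s \<le> n") (simp_all add: binomial_le_pow binomial_eq_0)
    finally have "card P \<le> n ^ s" .
    then have "card \<G> \<le> n ^ s * n ^ s"
      unfolding \<G>_def using card_image_le[of "P \<times> P" "\<lambda>(S, T). S \<times> T"] finP
      by (simp add: card_cartesian_product) (meson mult_le_mono order_trans)
    also have "n ^ s * n ^ s = q ^ (d * s + d * s)" by (simp add: n power_mult power_add)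
    also have "d * s + d * s = 2 * d * s" by simp
    finally have "2 * card F * card \<G> \<le> q * q * q ^ (2 * d * s)"
      using q F(2) by (intro mult_le_mono) auto
    also have "\<dots> = q ^ (2 + 2 * d * s)" by (simp add: power_add power2_eq_square)
    also have "\<dots> \<le> q ^ (s * s)"
      using q d by (intro power_increasing) (auto simp: s_def algebra_simps)
    finally show "2 * card F * card \<G> \<le> card F ^ (s * s)" using F(2) by simp
  qed
  then obtain f where f: "f \<in> \<Phi>" "card \<Omega> \<le> 2 * q * card {z\<in>\<Omega>. f z = 0}"
    "\<And>T. T \<in> \<G> \<Longrightarrow> \<exists>t\<in>T. f t \<noteq> 0" using F(2) by blast
  define E where "E = {z\<in>\<Omega>. f z = 0}"
  show ?thesis
  proof (intro exI[of _ E] conjI allI impI)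
    show "E \<subseteq> {..<n} \<times> {..<n}" by (auto simp: E_def \<Omega>_def)
    have "q * q ^ (2 * d - 1) = q ^ (2 * d)" using d by (cases d) auto
    also have "\<dots> = card \<Omega>" by (simp add: \<Omega>_def n mult_2 power_add)
    also have "\<dots> \<le> q * (2 * card E)" using f(2) by (simp add: E_def mult_ac)
    finally show "q ^ (2 * d - 1) \<le> 2 * card E" using q by simp
  next
    fix S T :: "nat set"
    assume ST: "card S = 2 * d + 1" "card T = 2 * d + 1"
    show "\<not> S \<times> T \<subseteq> E"
    proof
      assume sub: "S \<times> T \<subseteq> E"
      have "S \<noteq> {}" "T \<noteq> {}" using ST by auto
      then have "S \<in> P" "T \<in> P" using sub ST by (auto simp: P_def s_def E_def \<Omega>_def)
      then have "S \<times> T \<in> \<G>" by (auto simp: \<G>_def)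
      then show False using f(3) sub by (force simp: E_def)
    qed
  next
    fix C assume C: "C \<subseteq> {..<n}"
    then have "\<forall>j\<in>C. \<exists>g. g \<in> polyfuns d (2 * d) \<and> (\<forall>i\<in>{..<n}. f (i, j) = g (e i))"
      using f(1) unfolding \<Phi>_def bipolynomials_def by blast
    from bchoice[OF this] obtain p where p: "\<And>j. j \<in> C \<Longrightarrow> p j \<in> polyfuns d (2 * d)"
      "\<And>i j. i < n \<Longrightarrow> j \<in> C \<Longrightarrow> f (i, j) = p j (e i)" by auto
    have "(\<lambda>i. {j\<in>C. (i, j) \<in> E}) ` {..<n} = (\<lambda>y. {j\<in>C. p j y = 0}) ` e ` {..<n}"
      unfolding image_image using C p(2) by (intro image_cong) (auto simp: E_def \<Omega>_def)
    then show "card ((\<lambda>i. {j\<in>C. (i, j) \<in> E}) ` {..<n}) \<le> (card C * (2 * d) + 1) ^ d"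
      using card_zero_patterns_le[of C p d "2 * d"] p(1) finite_subset[OF C] by simp
  next
    fix C assume C: "C \<subseteq> {..<n}"
    then have "\<forall>i\<in>C. \<exists>g. g \<in> polyfuns d (2 * d) \<and> (\<forall>j\<in>{..<n}. f (i, j) = g (e j))"
      using f(1) unfolding \<Phi>_def bipolynomials_def by blast
    from bchoice[OF this] obtain p where p: "\<And>i. i \<in> C \<Longrightarrow> p i \<in> polyfuns d (2 * d)"
      "\<And>i j. i \<in> C \<Longrightarrow> j < n \<Longrightarrow> f (i, j) = p i (e j)" by auto
    have "(\<lambda>j. {i\<in>C. (i, j) \<in> E}) ` {..<n} = (\<lambda>y. {i\<in>C. p i y = 0}) ` e ` {..<n}"
      unfolding image_image using C p(2) by (intro image_cong) (auto simp: E_def \<Omega>_def)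
    then show "card ((\<lambda>j. {i\<in>C. (i, j) \<in> E}) ` {..<n}) \<le> (card C * (2 * d) + 1) ^ d"
      using card_zero_patterns_le[of C p d "2 * d"] p(1) finite_subset[OF C] by simp
  qed
qed

section \<open>Large finite subfields of an algebraic closure\<close>

text \<open>A repeated linear factor would give a common root of the polynomial and its derivative.\<close>

lemma card_roots_separable:
  fixes p :: "'a::alg_closed_field poly"
  assumes "p \<noteq> 0" and sep: "\<And>x. poly p x = 0 \<Longrightarrow> poly (pderiv p) x \<noteq> 0"
  shows "card {x. poly p x = 0} = degree p"
proof -
  obtain A where A: "size A = degree p" "p = smult (lead_coeff p) (\<Prod>x\<in>#A. [:-x, 1:])"
    using alg_closed_imp_factorization[OF \<open>p \<noteq> 0\<close>] by blast
  have roots: "poly p x = 0 \<longleftrightarrow> x \<in># A" for x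
  proof -
    have "poly p x = lead_coeff p * (\<Prod>y\<in>#A. x - y)"
      by (subst A(2)) (simp add: poly_prod_mset image_mset.compositionality o_def)
    then show ?thesis using \<open>p \<noteq> 0\<close> by auto
  qed
  have le1: "count A x \<le> 1" for x
  proof (rule ccontr)
    assume "\<not> count A x \<le> 1"
    then have "count A x \<ge> Suc (Suc 0)" by simp
    then have "{#x, x#} \<subseteq># A"
      by (intro mset_subset_eqI) auto
    then obtain B where "A = {#x, x#} + B" by (auto simp: mset_subset_eq_exists_conv)
    moreover define r where "r = smult (lead_coeff p) (\<Prod>x\<in>#B. [:-x, 1:])"
    ultimately have "p = [:-x, 1:] * ([:-x, 1:] * r)"
      using A(2) by simp
    then have "poly (pderiv p) x = poly (pderiv ([:-x, 1:] * ([:-x, 1:] * r))) x"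
      by simp
    also have "\<dots> = 0" by (simp add: pderiv_mult del: mult_pCons_left)
    finally have "poly (pderiv p) x = 0" .
    moreover have "poly p x = 0" using roots \<open>A = _\<close> by simp
    ultimately show False using sep by blast
  qed
  have "count (mset_set (set_mset A)) x = count A x" for x
  proof (cases "x \<in># A")
    case True
    then have "0 < count A x" by simp
    then have "count A x = 1" using le1[of x] by linarith
    then show ?thesis using True by simp
  qed (simp add: not_in_iff)
  then have "mset_set (set_mset A) = A" by (intro multiset_eqI)
  then have "card (set_mset A) = size A" using size_mset_set[of "set_mset A"] by argo
  moreover have "{x. poly p x = 0} = set_mset A" using roots by blast
  ultimately show ?thesis using A(1) by argo
qed

text \<open>
  The usual construction of the field with \<open>q = 2 ^ k\<close> elements: the roots of \<open>X ^ q - X\<close> are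
  closed under the field operations because \<open>x \<mapsto> x ^ q\<close> is a field homomorphism, and there are \<open>q\<close>
  of them because the derivative is the constant \<open>- 1\<close>.
\<close>

lemma ex_finite_subfield:
  assumes "k \<ge> 1"
  shows "\<exists>F :: bit alg_closure set. finite_subfield F \<and> card F = 2 ^ k"
proof -
  define q where "q = (2::nat) ^ k"
  have q: "q \<ge> 2" "even q" using assms by (auto simp: q_def intro: self_le_power)
  define F where "F = {x :: bit alg_closure. x ^ q = x}"
  define p where "p = monom (1 :: bit alg_closure) q - monom 1 1"
  have "to_ac (1 + 1 :: bit) = to_ac 0" by simp
  then have two: "(2 :: bit alg_closure) = 0"
    by (metis one_add_one to_ac_0 to_ac_1 to_ac_add)
  have neg: "- x = x" for x :: "bit alg_closure"
  proof -
    have "x + x = 0" using two mult_2[of x] by simp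
    then show ?thesis by (simp add: add_eq_0_iff)
  qed
  have diff: "x - y = x + y" for x y :: "bit alg_closure"
    unfolding diff_conv_add_uminus[of x y] neg ..
  have frob: "(x + y) ^ 2 ^ j = x ^ 2 ^ j + y ^ 2 ^ j" for x y :: "bit alg_closure" and j
  proof (induction j)
    case (Suc j)
    have "(x + y) ^ 2 ^ Suc j = ((x + y) ^ 2 ^ j) ^ 2" by (simp add: power_mult[symmetric] mult.commute)
    also have "\<dots> = (x ^ 2 ^ j) ^ 2 + (y ^ 2 ^ j) ^ 2" by (simp add: Suc power2_sum two)
    finally show ?case by (simp add: power_mult[symmetric] mult.commute)
  qed simp
  have "coeff p q = 1" using q by (simp add: p_def)
  then have p0: "p \<noteq> 0" by auto
  have deg: "degree p = q"
  proof (rule antisym)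
    show "degree p \<le> q" using q by (auto simp: p_def intro!: degree_diff_le degree_monom_le[THEN order_trans])
    show "q \<le> degree p" using \<open>coeff p q = 1\<close> by (simp add: le_degree)
  qed
  have "of_nat q = (0 :: bit alg_closure)"
    using q(2) two by (auto elim!: evenE)
  then have "pderiv p = -1" by (simp add: p_def pderiv_diff pderiv_monom)
  then have "card {x. poly p x = 0} = q"
    using card_roots_separable[OF p0] deg by simp
  moreover have "{x. poly p x = 0} = F" by (auto simp: p_def F_def poly_monom)
  ultimately have card: "card F = q" by simp
  have "finite F" using card q card.infinite by fastforce
  moreover have "x - y \<in> F" if "x \<in> F" "y \<in> F" for x y
    using that frob[of x y k] by (simp add: F_def q_def diff)
  ultimately have "finite_subfield F"
    unfolding finite_subfield_def using q by (auto simp: F_def power_mult_distrib power_inverse)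
  then show ?thesis using card q_def by blast
qed

section \<open>Bipartite graphs without large complete bipartite subgraphs\<close>

text \<open>
  A biclique with sides \<open>U\<close> and \<open>V\<close>, one of them smaller than \<open>s\<close>, has at most
  \<open>s * (card U + card V)\<close> edges, that is, at most \<open>2 * s\<close> arcs per vertex.
\<close>

lemma card_arcs_le_biclique_cover_size:
  assumes G: "pair_graph G" and cover: "biclique_cover G \<B>"
    and free: "\<And>S T. card S = s \<Longrightarrow> card T = s \<Longrightarrow> \<not> S \<times> T \<subseteq> parcs G"
  shows "card (parcs G) \<le> 2 * s * biclique_cover_size \<B>"
proof -
  have arcs: "finite (parcs B) \<and> card (parcs B) \<le> 2 * s * card (pverts B)" if "B \<in> \<B>" for B
  proof -
    have "biclique G B" using that cover by (simp add: biclique_def biclique_cover_def)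
    then have sub: "parcs B \<subseteq> parcs G" and "\<exists>a b. complete_bipartite_digraph a b (with_proj B)"
      by (simp_all add: biclique_def subgraph_def)
    then obtain U V where fin: "finite (pverts B)"
      and UV: "pverts B = U \<union> V" "U \<inter> V = {}" "parcs B = U \<times> V \<union> V \<times> U"
      unfolding complete_bipartite_digraph_pair_def by blast
    have finUV: "finite U" "finite V" using fin UV(1) by auto
    have "card U < s \<or> card V < s"
    proof (rule ccontr)
      assume "\<not> ?thesis"
      then obtain S T where "S \<subseteq> U" "card S = s" "T \<subseteq> V" "card T = s"
        by (meson not_less obtain_subset_with_card_n)
      then show False using free[of S T] sub UV(3) by blast
    qed
    then have "card U * card V \<le> s * (card U + card V)"
    proof
      assume "card U < s"
      then have "card U * card V \<le> s * card V" by (intro mult_le_mono1) simp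
      then show ?thesis by (simp only: distrib_left)
    next
      assume "card V < s"
      then have "card U * card V \<le> card U * s" by (intro mult_le_mono2) simp
      then show ?thesis by (simp only: distrib_left mult.commute[of s "card U"])
    qed
    moreover have "card (parcs B) \<le> card U * card V + card V * card U"
      unfolding UV(3) by (rule order_trans[OF card_Un_le]) (simp add: card_cartesian_product)
    moreover have "card (pverts B) = card U + card V"
      using UV(1,2) finUV by (simp add: card_Un_disjoint)
    ultimately show ?thesis using finUV UV(3) by (simp add: algebra_simps)
  qed
  have "finite \<B>" using G cover by (rule finite_biclique_cover)
  have "parcs G \<subseteq> (\<Union>B\<in>\<B>. parcs B)" using cover by (auto simp: biclique_cover_def)
  then have "card (parcs G) \<le> card (\<Union>B\<in>\<B>. parcs B)"
    using \<open>finite \<B>\<close> arcs by (intro card_mono) auto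
  also have "\<dots> \<le> (\<Sum>B\<in>\<B>. card (parcs B))" using \<open>finite \<B>\<close> by (rule card_UN_le)
  also have "\<dots> \<le> (\<Sum>B\<in>\<B>. 2 * s * card (pverts B))" using arcs by (intro sum_mono) auto
  finally show ?thesis by (simp add: biclique_cover_size_def sum_distrib_left)
qed

definition bipartite_graph :: "nat \<Rightarrow> (nat \<times> nat) set \<Rightarrow> nat pair_pre_digraph" where
  "bipartite_graph n E = \<lparr> pverts = {..<2 * n},
     parcs = (\<lambda>(i, j). (i, n + j)) ` E \<union> (\<lambda>(i, j). (n + j, i)) ` E \<rparr>"

locale bipartite_relation =
  fixes n :: nat and E :: "(nat \<times> nat) set"
  assumes E: "E \<subseteq> {..<n} \<times> {..<n}"
begin

lemma finite_E: "finite E"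
  using E by (rule finite_subset) simp

lemma pair_graph_bipartite_graph: "pair_graph (bipartite_graph n E)"
proof
  show "symmetric (bipartite_graph n E)"
    by (auto simp: symmetric_def sym_def bipartite_graph_def arcs_ends_def arc_to_ends_def with_proj_def)
qed (use E finite_E in \<open>auto simp: bipartite_graph_def\<close>)

lemma card_parcs_bipartite_graph: "card (parcs (bipartite_graph n E)) = 2 * card E"
proof -
  have "card ((\<lambda>(i, j). (i, n + j)) ` E) = card E" "card ((\<lambda>(i, j). (n + j, i)) ` E) = card E"
    by (auto intro!: card_image inj_onI)
  moreover have "(\<lambda>(i, j). (i, n + j)) ` E \<inter> (\<lambda>(i, j). (n + j, i)) ` E = {}" using E by auto
  ultimately show ?thesis by (simp add: bipartite_graph_def card_Un_disjoint finite_E)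
qed

text \<open>
  Fixing one vertex of \<open>S\<close> forces \<open>T\<close> to the other side of the graph, and then \<open>T\<close> does the same
  to \<open>S\<close>. So a biclique of the graph is, up to exchanging its sides, a grid in \<open>E\<close>.
\<close>

lemma grid_in_bipartite_graph:
  assumes "S \<times> T \<subseteq> parcs (bipartite_graph n E)" "card S = s" "card T = s" "s > 0"
  shows "\<exists>S' T'. card S' = s \<and> card T' = s \<and> S' \<times> T' \<subseteq> E"
proof -
  have arc: "(i < n \<and> n \<le> j \<and> (i, j - n) \<in> E) \<or> (n \<le> i \<and> j < n \<and> (j, i - n) \<in> E)" if "i \<in> S" "j \<in> T" for i j
    using that assms(1) E unfolding bipartite_graph_def by fastforce
  have shift: "card ((\<lambda>i. i - n) ` A) = card A" if "\<And>i. i \<in> A \<Longrightarrow> n \<le> i" for A :: "nat set"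
    using that by (intro card_image inj_onI) (metis le_add_diff_inverse)
  obtain i j where ij: "i \<in> S" "j \<in> T" using assms(2-4) by (metis card_gt_0_iff ex_in_conv)
  show ?thesis
  proof (cases "i < n")
    case True
    then have T: "n \<le> b" if "b \<in> T" for b using arc[OF ij(1) that] by linarith
    have "(a, b - n) \<in> E" if "a \<in> S" "b \<in> T" for a b using arc[OF that] T[OF that(2)] by auto
    then show ?thesis using shift[OF T] assms(2,3)
      by (intro exI[of _ S] exI[of _ "(\<lambda>b. b - n) ` T"]) auto
  next
    case False
    then have "b < n" if "b \<in> T" for b using arc[OF ij(1) that] by linarith
    then have ET: "n \<le> a \<and> (b, a - n) \<in> E" if "a \<in> S" "b \<in> T" for a b
      using arc[OF that] that(2) by fastforce
    then have S: "n \<le> a" if "a \<in> S" for a using that ij(2) by blast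
    show ?thesis using shift[OF S] ET assms(2,3)
      by (intro exI[of _ T] exI[of _ "(\<lambda>a. a - n) ` S"]) auto
  qed
qed

text \<open>
  A vertex of one side only sees the part of \<open>C\<close> on the other side, which has at most \<open>m\<close>
  elements. So the traces split into two families, each counted by one of the hypotheses.
\<close>

lemma neighborhood_complexity_bipartite_graph_le:
  assumes "1 \<le> m" "m \<le> 2 * n"
    and right: "\<And>C. C \<subseteq> {..<n} \<Longrightarrow> card ((\<lambda>i. {j\<in>C. (i, j) \<in> E}) ` {..<n}) \<le> (card C * D + 1) ^ d"
    and left: "\<And>C. C \<subseteq> {..<n} \<Longrightarrow> card ((\<lambda>j. {i\<in>C. (i, j) \<in> E}) ` {..<n}) \<le> (card C * D + 1) ^ d"
  shows "neighborhood_complexity (bipartite_graph n E) m \<le> 2 * (D + 1) ^ d * m ^ d"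
proof -
  let ?G = "bipartite_graph n E"
  have bound: "card {neighborhood ?G v \<inter> C | v. v \<in> pverts ?G} \<le> 2 * (D + 1) ^ d * m ^ d"
    if C: "C \<subseteq> pverts ?G" "card C = m" for C
  proof -
    have "finite C" using C(1) by (rule finite_subset) (simp add: bipartite_graph_def)
    define R where "R = {j. j < n \<and> n + j \<in> C}"
    define L where "L = {i\<in>C. i < n}"
    define \<R> where "\<R> = (\<lambda>i. {j\<in>R. (i, j) \<in> E}) ` {..<n}"
    define \<L> where "\<L> = (\<lambda>j. {i\<in>L. (i, j) \<in> E}) ` {..<n}"
    have "card ((+) n ` R) \<le> card C" using \<open>finite C\<close> by (intro card_mono) (auto simp: R_def)
    then have "card R \<le> m" using C(2) by (simp add: card_image)
    have "card L \<le> m" using \<open>finite C\<close> C(2) by (auto simp: L_def intro: card_mono)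
    have grow: "(k * D + 1) ^ d \<le> (D + 1) ^ d * m ^ d" if "k \<le> m" for k
    proof -
      have "k * D \<le> m * D" using that by (rule mult_le_mono1)
      then have "k * D + 1 \<le> m * D + m" using \<open>1 \<le> m\<close> by linarith
      then have "k * D + 1 \<le> (D + 1) * m" by (simp add: algebra_simps)
      then show ?thesis by (metis power_mono power_mult_distrib zero_le)
    qed
    have "card \<R> \<le> (D + 1) ^ d * m ^ d"
      using right[of R] grow[OF \<open>card R \<le> m\<close>] by (force simp: R_def \<R>_def intro: order_trans)
    moreover have "card \<L> \<le> (D + 1) ^ d * m ^ d"
      using left[of L] grow[OF \<open>card L \<le> m\<close>] by (force simp: L_def \<L>_def intro: order_trans)
    moreover have "{neighborhood ?G v \<inter> C | v. v \<in> pverts ?G} \<subseteq> (\<lambda>A. (+) n ` A) ` \<R> \<union> \<L>"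
    proof safe
      fix v assume v: "v \<in> pverts ?G" and "neighborhood ?G v \<inter> C \<notin> \<L>"
      have "v < n"
      proof (rule ccontr)
        assume "\<not> v < n"
        then have "neighborhood ?G v \<inter> C = {i\<in>L. (i, v - n) \<in> E}"
          using E by (force simp: neighborhood_def bipartite_graph_def L_def)
        moreover have "v - n < n" using v by (simp add: bipartite_graph_def)
        ultimately show False using \<open>_ \<notin> \<L>\<close> by (auto simp: \<L>_def)
      qed
      then have "neighborhood ?G v \<inter> C = (+) n ` {j\<in>R. (v, j) \<in> E}"
        using E by (force simp: neighborhood_def bipartite_graph_def R_def)
      then show "neighborhood ?G v \<inter> C \<in> (\<lambda>A. (+) n ` A) ` \<R>" using \<open>v < n\<close> by (auto simp: \<R>_def)
    qed
    then have "card {neighborhood ?G v \<inter> C | v. v \<in> pverts ?G} \<le> card ((\<lambda>A. (+) n ` A) ` \<R> \<union> \<L>)"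
      by (rule card_mono[rotated]) (simp add: \<R>_def \<L>_def)
    moreover have "\<dots> \<le> card ((\<lambda>A. (+) n ` A) ` \<R>) + card \<L>" by (rule card_Un_le)
    moreover have "card ((\<lambda>A. (+) n ` A) ` \<R>) \<le> card \<R>" by (rule card_image_le) (simp add: \<R>_def)
    ultimately show ?thesis by linarith
  qed
  let ?K = "{card {neighborhood ?G v \<inter> C | v. v \<in> pverts ?G} | C. C \<subseteq> pverts ?G \<and> card C = m}"
  have "?K \<subseteq> (\<lambda>C. card {neighborhood ?G v \<inter> C | v. v \<in> pverts ?G}) ` Pow {..<2 * n}"
    by (auto simp: bipartite_graph_def)
  then have "finite ?K" by (rule finite_subset) simp
  moreover have "card {..<m} = m" "{..<m} \<subseteq> pverts ?G" using \<open>m \<le> 2 * n\<close> by (auto simp: bipartite_graph_def)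
  then have "?K \<noteq> {}" by blast
  ultimately have "Max ?K \<in> ?K" by (rule Max_in)
  then show ?thesis using bound unfolding neighborhood_complexity_def by auto
qed

end

section \<open>Graphs whose biclique covers are large\<close>

theorem theorem15:
  fixes d :: nat
  assumes "d \<ge> 1"
  shows "\<exists>(c::int) (\<kappa>::real). \<kappa> > 0 \<and>
    (\<forall>N. \<exists>n\<ge>N. \<exists>G :: nat pair_pre_digraph.
       pair_graph G \<and> card (pverts G) = n \<and>
       (\<forall>m\<in>{1..n}. int (neighborhood_complexity G m) \<le> c * int m ^ d) \<and>
       (\<forall>\<B>. biclique_cover G \<B> \<longrightarrow>
          real (biclique_cover_size \<B>) \<ge> \<kappa> * real n powr (2 - 1 / real d)))"
proof (rule exI, rule exI, intro conjI allI)
  let ?s = "2 * d + 1"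
  let ?c = "int (2 * (2 * d + 1) ^ d)" and ?\<kappa> = "1 / (8 * real ?s)"
  show "?\<kappa> > 0" by simp
  fix N :: nat
  define k where "k = Suc N"
  define q where "q = (2::nat) ^ k"
  define n where "n = q ^ d"
  obtain F :: "bit alg_closure set" where F: "finite_subfield F" "card F = q"
    using ex_finite_subfield[of k] by (auto simp: k_def q_def)
  obtain E where rel: "E \<subseteq> {..<n} \<times> {..<n}" and dense: "q ^ (2 * d - 1) \<le> 2 * card E"
    and grid_free: "\<And>S T. card S = ?s \<Longrightarrow> card T = ?s \<Longrightarrow> \<not> S \<times> T \<subseteq> E"
    and right: "\<And>C. C \<subseteq> {..<n} \<Longrightarrow> card ((\<lambda>i. {j\<in>C. (i, j) \<in> E}) ` {..<n}) \<le> (card C * (2 * d) + 1) ^ d"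
    and left: "\<And>C. C \<subseteq> {..<n} \<Longrightarrow> card ((\<lambda>j. {i\<in>C. (i, j) \<in> E}) ` {..<n}) \<le> (card C * (2 * d) + 1) ^ d"
    using ex_dense_grid_free_relation[OF F \<open>d \<ge> 1\<close> n_def] by blast
  interpret bipartite_relation n E by unfold_locales (rule rel)
  let ?G = "bipartite_graph n E"
  have "N < q" unfolding q_def k_def using less_exp[of "Suc N"] by linarith
  moreover have "q \<le> n" using \<open>d \<ge> 1\<close> by (simp add: n_def q_def self_le_power)
  ultimately have "N \<le> 2 * n" by simp
  have complexity: "int (neighborhood_complexity ?G m) \<le> ?c * int m ^ d" if "m \<in> {1..2 * n}" for m
  proof -
    have "neighborhood_complexity ?G m \<le> 2 * (2 * d + 1) ^ d * m ^ d"
      using that right left by (intro neighborhood_complexity_bipartite_graph_le) auto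
    then have "int (neighborhood_complexity ?G m) \<le> int (2 * (2 * d + 1) ^ d * m ^ d)" by (simp only: of_nat_le_iff)
    then show ?thesis by (simp only: of_nat_mult of_nat_power)
  qed
  have cover: "real (biclique_cover_size \<B>) \<ge> ?\<kappa> * real (2 * n) powr (2 - 1 / real d)"
    if "biclique_cover ?G \<B>" for \<B>
  proof -
    have "\<not> S \<times> T \<subseteq> parcs ?G" if "card S = ?s" "card T = ?s" for S T
      using grid_in_bipartite_graph[of S T ?s] that grid_free by auto
    then have "card (parcs ?G) \<le> 2 * ?s * biclique_cover_size \<B>"
      by (rule card_arcs_le_biclique_cover_size[OF pair_graph_bipartite_graph that])
    then have "q ^ (2 * d - 1) \<le> 2 * ?s * biclique_cover_size \<B>"
      using dense card_parcs_bipartite_graph by linarith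
    then have "real (q ^ (2 * d - 1)) \<le> real (2 * ?s * biclique_cover_size \<B>)" by (simp only: of_nat_le_iff)
    then have size: "real q ^ (2 * d - 1) \<le> 2 * real ?s * real (biclique_cover_size \<B>)"
      by (simp only: of_nat_mult of_nat_power of_nat_numeral)
    have "q > 0" by (simp add: q_def)
    \<comment> \<open>In terms of \<open>q\<close>, the bound to be reached is \<open>q ^ (2 * d - 1)\<close>, up to the constant
      \<open>2 powr (2 - 1 / d)\<close> that stems from having two copies of \<open>F^d\<close>.\<close>
    have exponent: "real d * (2 - 1 / real d) = real (2 * d - 1)"
      using \<open>d \<ge> 1\<close> by (simp add: field_simps)
    have "(real q ^ d) powr (2 - 1 / real d) = (real q powr real d) powr (2 - 1 / real d)"
      using \<open>q > 0\<close> by (simp only: powr_realpow of_nat_0_less_iff)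
    also have "\<dots> = real q powr real (2 * d - 1)" by (simp only: powr_powr exponent)
    also have "\<dots> = real q ^ (2 * d - 1)" using \<open>q > 0\<close> by (simp only: powr_realpow of_nat_0_less_iff)
    finally have "(real q ^ d) powr (2 - 1 / real d) = real q ^ (2 * d - 1)" .
    moreover have "2 powr (2 - 1 / real d) \<le> (2::real) powr 2" by (intro powr_mono) auto
    ultimately have "real (2 * n) powr (2 - 1 / real d) \<le> 4 * real q ^ (2 * d - 1)"
      using \<open>q > 0\<close> by (simp add: n_def powr_mult)
    also have "\<dots> \<le> 4 * (2 * real ?s * real (biclique_cover_size \<B>))" using size by simp
    also have "\<dots> = 8 * real ?s * real (biclique_cover_size \<B>)" by (simp add: algebra_simps)
    finally have "real (2 * n) powr (2 - 1 / real d) \<le> 8 * real ?s * real (biclique_cover_size \<B>)" .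
    moreover have "0 < 8 * real ?s" by simp
    ultimately show ?thesis
      by (simp only: times_divide_eq_left mult_1_left pos_divide_le_eq
          mult.commute[of "real (biclique_cover_size \<B>)"])
  qed
  show "\<exists>n\<ge>N. \<exists>G :: nat pair_pre_digraph.
       pair_graph G \<and> card (pverts G) = n \<and>
       (\<forall>m\<in>{1..n}. int (neighborhood_complexity G m) \<le> ?c * int m ^ d) \<and>
       (\<forall>\<B>. biclique_cover G \<B> \<longrightarrow>
          real (biclique_cover_size \<B>) \<ge> ?\<kappa> * real n powr (2 - 1 / real d))"
    using \<open>N \<le> 2 * n\<close> pair_graph_bipartite_graph complexity cover
    by (intro exI[of _ "2 * n"] exI[of _ ?G] conjI ballI allI impI) (simp_all add: bipartite_graph_def)
qed

end
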